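(* Let $R$ be a commutative Noetherian ring, $I$ an ideal of $R$ and $M$ a finitely generated $R$-module. Then $\widetilde{\mathcal R}(I,M)=\bigoplus_{n\geq 0}\widetilde{I^nM}$ is a graded module over the graded ring $\mathcal{R}(\mathcal{F}^I_M)=\bigoplus_{n\geq 0} r(I^n,M)$.
   Context: For submodules $A,B$ of $M$ and an ideal $L$ of $R$: $(A:B)=\{x\in R : xB\subseteq A\}$ and $(A:_M L)=\{m\in M : Lm\subseteq A\}$. Define $r(L,M)=\bigcup_{k\geq 1}(L^{k+1}M:L^kM)$ and $\widetilde{LM}=\bigcup_{k\geq 1}(L^{k+1}M:_M L^k)$ (ascending unions). Equivalently, for $n\ge1$, $r(I^n,M)=\bigcup_{k\geq 1}(I^{n+k}M:I^kM)$ and $\widetilde{I^nM}=\bigcup_{k\geq 1}(I^{n+k}M:_M I^k)$; for $n=0$, $r(I^0,M)=R$ and $\widetilde{I^0M}=M$. The ideals $r(I^n,M)$ form a filtration ($r(I^n,M)\,r(I^m,M)\subseteq r(I^{n+m},M)$), so $\mathcal{R}(\mathcal{F}^I_M)$ is a graded ring (the Rees algebra of the filtration). The module structure is the one induced by the scalar multiplication of $R$ on $M$: the product of $x\in r(I^n,M)$ in degree $n$ and $z\in\widetilde{I^mM}$ in degree $m$ is $xz$ in degree $n+m$. *)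

theory Defs
  imports "HOL-Algebra.Algebra"
begin

section \<open>Submodules, colons and Ratliff-Rush closures\<close>

definition generated_submodule ::
    "('a, 'r) ring_scheme \<Rightarrow> ('a, 'b, 'm) module_scheme \<Rightarrow> 'b set \<Rightarrow> 'b set"
  where "generated_submodule R M A = \<Inter>{N. submodule N R M \<and> A \<subseteq> N}"

definition finitely_generated_module ::
    "('a, 'r) ring_scheme \<Rightarrow> ('a, 'b, 'm) module_scheme \<Rightarrow> bool"
  where "finitely_generated_module R M \<longleftrightarrow>
    (\<exists>A \<subseteq> carrier M. finite A \<and> generated_submodule R M A = carrier M)"

definition ideal_smult ::
    "('a, 'r) ring_scheme \<Rightarrow> ('a, 'b, 'm) module_scheme \<Rightarrow> 'a set \<Rightarrow> 'b set \<Rightarrow> 'b set"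
  where "ideal_smult R M L N = generated_submodule R M {a \<odot>\<^bsub>M\<^esub> x | a x. a \<in> L \<and> x \<in> N}"

text \<open>Powers of ideals are taken in the multiplicative monoid \<^term>\<open>ideals_set R\<close> of
  ideals of \<open>R\<close>, whose unit is \<^term>\<open>carrier R\<close>; so \<open>L\<^sup>0 = R\<close>.\<close>

abbreviation ideal_power :: "('a, 'r) ring_scheme \<Rightarrow> 'a set \<Rightarrow> nat \<Rightarrow> 'a set"
  where "ideal_power R L k \<equiv> L [^]\<^bsub>ideals_set R\<^esub> k"

definition colon_ideal ::
    "('a, 'r) ring_scheme \<Rightarrow> ('a, 'b, 'm) module_scheme \<Rightarrow> 'b set \<Rightarrow> 'b set \<Rightarrow> 'a set"
  where "colon_ideal R M A B = {x \<in> carrier R. \<forall>b \<in> B. x \<odot>\<^bsub>M\<^esub> b \<in> A}"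

definition colon_submodule ::
    "('a, 'b, 'm) module_scheme \<Rightarrow> 'b set \<Rightarrow> 'a set \<Rightarrow> 'b set"
  where "colon_submodule M A L = {m \<in> carrier M. \<forall>l \<in> L. l \<odot>\<^bsub>M\<^esub> m \<in> A}"

text \<open>The ideal \<open>r(L, M)\<close>: the union over \<open>k \<ge> 1\<close> of \<open>(L\<^sup>k\<^sup>+\<^sup>1 M : L\<^sup>k M)\<close>.\<close>

definition r_ideal ::
    "('a, 'r) ring_scheme \<Rightarrow> ('a, 'b, 'm) module_scheme \<Rightarrow> 'a set \<Rightarrow> 'a set"
  where "r_ideal R M L =
    (\<Union>k\<in>{1..}. colon_ideal R M
       (ideal_smult R M (ideal_power R L (k + 1)) (carrier M))
       (ideal_smult R M (ideal_power R L k) (carrier M)))"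

text \<open>The Ratliff-Rush closure of \<open>LM\<close>: the union over \<open>k \<ge> 1\<close> of
  \<open>(L\<^sup>k\<^sup>+\<^sup>1 M :\<^sub>M L\<^sup>k)\<close>.  It is a function of \<open>L\<close> rather than of the submodule \<open>LM\<close>.\<close>

definition ratliff_rush ::
    "('a, 'r) ring_scheme \<Rightarrow> ('a, 'b, 'm) module_scheme \<Rightarrow> 'a set \<Rightarrow> 'b set"
  where "ratliff_rush R M L =
    (\<Union>k\<in>{1..}. colon_submodule M
       (ideal_smult R M (ideal_power R L (k + 1)) (carrier M))
       (ideal_power R L k))"

section \<open>Graded rings and modules\<close>

definition graded_by :: "('a, 'r) ring_scheme \<Rightarrow> (nat \<Rightarrow> 'a set) \<Rightarrow> bool"
  where "graded_by G A \<longleftrightarrow>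
    (\<forall>n. additive_subgroup (A n) G) \<and>
    (\<forall>x \<in> carrier G. \<exists>!f. (\<forall>n. f n \<in> A n) \<and> finite {n. f n \<noteq> \<zero>\<^bsub>G\<^esub>} \<and>
        x = (\<Oplus>\<^bsub>G\<^esub>n\<in>{n. f n \<noteq> \<zero>\<^bsub>G\<^esub>}. f n))"

locale graded_ring = ring S for S :: "('a, 'r) ring_scheme" (structure) and A :: "nat \<Rightarrow> 'a set" +
  assumes ring_graded_by: "graded_by S A"
    and graded_mult: "\<lbrakk>x \<in> A m; y \<in> A n\<rbrakk> \<Longrightarrow> x \<otimes> y \<in> A (m + n)"

locale graded_module = S: graded_ring S A + module S N
  for S :: "('a, 'r) ring_scheme" (structure) and A
    and N :: "('a, 'b, 'm) module_scheme" (structure) and B :: "nat \<Rightarrow> 'b set" +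
  assumes module_graded_by: "graded_by N B"
    and graded_smult: "\<lbrakk>x \<in> A m; z \<in> B n\<rbrakk> \<Longrightarrow> x \<odot>\<^bsub>N\<^esub> z \<in> B (m + n)"

section \<open>External direct sums\<close>

definition direct_sum_carrier :: "('a, 'r) ring_scheme \<Rightarrow> (nat \<Rightarrow> 'a set) \<Rightarrow> (nat \<Rightarrow> 'a) set"
  where "direct_sum_carrier G F = {f. (\<forall>n. f n \<in> F n) \<and> finite {n. f n \<noteq> \<zero>\<^bsub>G\<^esub>}}"

definition in_degree :: "('a, 'r) ring_scheme \<Rightarrow> nat \<Rightarrow> 'a \<Rightarrow> (nat \<Rightarrow> 'a)"
  where "in_degree G n x = (\<lambda>m. if m = n then x else \<zero>\<^bsub>G\<^esub>)"

definition homogeneous_part ::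
    "('a, 'r) ring_scheme \<Rightarrow> (nat \<Rightarrow> 'a set) \<Rightarrow> nat \<Rightarrow> (nat \<Rightarrow> 'a) set"
  where "homogeneous_part G F n = in_degree G n ` F n"

text \<open>The convolution product is the additive extension of: \<open>x\<close> in degree \<open>m\<close> times \<open>y\<close>
  in degree \<open>n\<close> is \<open>xy\<close> in degree \<open>m + n\<close>.\<close>

definition rees_ring :: "('a, 'r) ring_scheme \<Rightarrow> (nat \<Rightarrow> 'a set) \<Rightarrow> (nat \<Rightarrow> 'a) ring"
  where "rees_ring R F =
    \<lparr>carrier = direct_sum_carrier R F,
     monoid.mult = (\<lambda>f g n. \<Oplus>\<^bsub>R\<^esub>i\<in>{..n}. f i \<otimes>\<^bsub>R\<^esub> g (n - i)),
     one = in_degree R 0 \<one>\<^bsub>R\<^esub>,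
     ring.zero = (\<lambda>n. \<zero>\<^bsub>R\<^esub>),
     add = (\<lambda>f g n. f n \<oplus>\<^bsub>R\<^esub> g n)\<rparr>"

text \<open>The fields \<open>mult\<close> and \<open>one\<close> of a module record play no role in the locale
  \<^locale>\<open>module\<close>.\<close>

definition rees_module ::
    "('a, 'b, 'm) module_scheme \<Rightarrow> (nat \<Rightarrow> 'b set) \<Rightarrow> (nat \<Rightarrow> 'a, nat \<Rightarrow> 'b) module"
  where "rees_module M G =
    \<lparr>carrier = direct_sum_carrier M G,
     monoid.mult = undefined,
     one = undefined,
     ring.zero = (\<lambda>n. \<zero>\<^bsub>M\<^esub>),
     add = (\<lambda>u v n. u n \<oplus>\<^bsub>M\<^esub> v n),
     smult = (\<lambda>f u n. \<Oplus>\<^bsub>M\<^esub>i\<in>{..n}. f i \<odot>\<^bsub>M\<^esub> u (n - i))\<rparr>"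

abbreviation r_filtration ::
    "('a, 'r) ring_scheme \<Rightarrow> ('a, 'b, 'm) module_scheme \<Rightarrow> 'a set \<Rightarrow> nat \<Rightarrow> 'a set"
  where "r_filtration R M I n \<equiv> r_ideal R M (ideal_power R I n)"

abbreviation ratliff_rush_filtration ::
    "('a, 'r) ring_scheme \<Rightarrow> ('a, 'b, 'm) module_scheme \<Rightarrow> 'a set \<Rightarrow> nat \<Rightarrow> 'b set"
  where "ratliff_rush_filtration R M I n \<equiv> ratliff_rush R M (ideal_power R I n)"

end

theory Submission
  imports Defs
begin

text \<open>
  The closures become manageable once their indices are freed from the powers of \<open>I\<^sup>n\<close>.
  If \<open>a I\<^sup>k M \<subseteq> I\<^sup>n\<^sup>+\<^sup>k M\<close> holds for one \<open>k\<close>, then multiplying by \<open>I\<^sup>j\<close> gives it for \<open>k + j\<close>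
  as well. Since \<open>(I\<^sup>n)\<^sup>k = I\<^sup>n\<^sup>k\<close> and, for \<open>n \<ge> 1\<close>, the multiples of \<open>n\<close> are unbounded, the union
  that defines \<open>r(I\<^sup>n, M)\<close> consists of those \<open>a\<close> with \<open>a I\<^sup>k M \<subseteq> I\<^sup>n\<^sup>+\<^sup>k M\<close> for all large \<open>k\<close>;
  for \<open>n = 0\<close> both conditions hold for every \<open>a\<close>. In the same way the Ratliff-Rush closure of
  \<open>I\<^sup>n M\<close> consists of those \<open>z\<close> with \<open>I\<^sup>k z \<subseteq> I\<^sup>n\<^sup>+\<^sup>k M\<close> for all large \<open>k\<close>. These are
  \<open>mem_r_filtration_iff\<close> and \<open>mem_ratliff_rush_filtration_iff\<close>.

  Conditions for all large \<open>k\<close> may be combined, so both families consist of additive subgroups.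
  They also compose: if \<open>a\<close> raises the degree by \<open>m\<close> and \<open>z\<close> is of degree \<open>n\<close>, then for large
  \<open>k\<close> one has \<open>I\<^sup>k (a z) = a (I\<^sup>k z) \<subseteq> a I\<^sup>n\<^sup>+\<^sup>k M \<subseteq> I\<^sup>m\<^sup>+\<^sup>n\<^sup>+\<^sup>k M\<close>, so \<open>a z\<close> has
  degree \<open>m + n\<close> (\<open>r_filtration_smult\<close>), and likewise for products of ring elements
  (\<open>r_filtration_mult\<close>).

  What remains is formal: any multiplicative family of additive subgroups of \<open>R\<close> with \<open>1\<close> in
  degree \<open>0\<close>, acting degree by degree on a family of additive subgroups of \<open>M\<close>, makes the direct
  sums into a graded ring and a graded module (\<open>graded_module_rees_module\<close>). The ring is the case
  \<open>M = R\<close> of the module, so associativity and distributivity of the convolution product are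
  proved only for the action; commutativity alone needs a separate argument.
\<close>

section \<open>External direct sums of additive subgroups\<close>

lemma (in abelian_group) finsum_mem_additive_subgroup:
  assumes H: "additive_subgroup H G" and "finite A" and "\<And>i. i \<in> A \<Longrightarrow> f i \<in> H"
  shows "(\<Oplus>i\<in>A. f i) \<in> H"
proof -
  interpret H: additive_subgroup H G by (rule H)
  have "H \<subseteq> carrier G" by (rule H.a_subset)
  with assms(2,3) show ?thesis
  proof (induction A rule: finite_induct)
    case (insert a A)
    then have "f a \<in> carrier G" "f \<in> A \<rightarrow> carrier G" by auto
    with insert show ?case by simp
  qed simp
qed

lemma (in abelian_group) additive_subgroup_criterion:
  assumes "H \<subseteq> carrier G" and "\<zero> \<in> H"
    and "\<And>x y. \<lbrakk>x \<in> H; y \<in> H\<rbrakk> \<Longrightarrow> x \<oplus> y \<in> H"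
    and "\<And>x. x \<in> H \<Longrightarrow> \<ominus> x \<in> H"
  shows "additive_subgroup H G"
  by (rule additive_subgroupI, rule add.subgroupI) (use assms in auto)

text \<open>
  The operations of \<open>S\<close> are prescribed only as far as the additive structure goes, so that the
  locale covers Rees rings and Rees modules alike.
\<close>

locale external_direct_sum = abelian_group G for G (structure) +
  fixes F :: "nat \<Rightarrow> 'a set" and S :: "(nat \<Rightarrow> 'a, 'c) ring_scheme"
  assumes additive_subgroup_component: "additive_subgroup (F n) G"
    and carrier_eq: "carrier S = direct_sum_carrier G F"
    and zero_eq: "\<zero>\<^bsub>S\<^esub> = (\<lambda>n. \<zero>)"
    and add_eq: "f \<oplus>\<^bsub>S\<^esub> g = (\<lambda>n. f n \<oplus> g n)"
begin

lemma component_subset: "x \<in> F n \<Longrightarrow> x \<in> carrier G"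
  using additive_subgroup.a_subset[OF additive_subgroup_component] by blast

lemma zero_in_component: "\<zero> \<in> F n"
  by (rule additive_subgroup.zero_closed[OF additive_subgroup_component])

lemma carrierD:
  assumes "f \<in> carrier S"
  shows "f n \<in> F n" "f n \<in> carrier G" "finite {n. f n \<noteq> \<zero>}"
  using assms component_subset by (auto simp: carrier_eq direct_sum_carrier_def)

lemma carrierI: "\<lbrakk>\<And>n. f n \<in> F n; finite {n. f n \<noteq> \<zero>}\<rbrakk> \<Longrightarrow> f \<in> carrier S"
  by (auto simp: carrier_eq direct_sum_carrier_def)

lemma add_closed:
  assumes "f \<in> carrier S" "g \<in> carrier S"
  shows "f \<oplus>\<^bsub>S\<^esub> g \<in> carrier S"
proof (rule carrierI)
  show "(f \<oplus>\<^bsub>S\<^esub> g) n \<in> F n" for n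
    using additive_subgroup.a_closed[OF additive_subgroup_component] carrierD assms
    by (simp add: add_eq)
  have "{n. (f \<oplus>\<^bsub>S\<^esub> g) n \<noteq> \<zero>} \<subseteq> {n. f n \<noteq> \<zero>} \<union> {n. g n \<noteq> \<zero>}"
    by (auto simp: add_eq)
  then show "finite {n. (f \<oplus>\<^bsub>S\<^esub> g) n \<noteq> \<zero>}"
    using carrierD assms by (meson finite_UnI finite_subset)
qed

lemma minus_in_carrier:
  assumes "f \<in> carrier S"
  shows "(\<lambda>n. \<ominus> f n) \<in> carrier S"
proof (rule carrierI)
  show "\<ominus> f n \<in> F n" for n
    using additive_subgroup.a_inv_closed[OF additive_subgroup_component] carrierD assms by simp
  have "{n. \<ominus> f n \<noteq> \<zero>} \<subseteq> {n. f n \<noteq> \<zero>}" by auto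
  then show "finite {n. \<ominus> f n \<noteq> \<zero>}"
    using carrierD assms by (meson finite_subset)
qed

lemma abelian_group_sum: "abelian_group S"
proof (rule abelian_groupI)
  show "\<zero>\<^bsub>S\<^esub> \<in> carrier S"
    by (rule carrierI) (auto simp: zero_eq zero_in_component)
  show "\<exists>g\<in>carrier S. g \<oplus>\<^bsub>S\<^esub> f = \<zero>\<^bsub>S\<^esub>" if "f \<in> carrier S" for f
    by (rule bexI[OF _ minus_in_carrier[OF that]])
       (use carrierD[OF that] in \<open>auto simp: add_eq zero_eq l_neg\<close>)
qed (auto simp: add_closed, auto simp: add_eq zero_eq carrierD a_ac)

sublocale S: abelian_group S
  by (rule abelian_group_sum)

lemma in_degree_closed: "x \<in> F n \<Longrightarrow> in_degree G n x \<in> carrier S"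
proof (rule carrierI)
  have "{k. in_degree G n x k \<noteq> \<zero>} \<subseteq> {n}" by (auto simp: in_degree_def)
  then show "finite {k. in_degree G n x k \<noteq> \<zero>}" by (rule finite_subset) simp
qed (auto simp: in_degree_def zero_in_component)

lemma finsum_apply:
  assumes "finite A" "h \<in> A \<rightarrow> carrier S"
  shows "(\<Oplus>\<^bsub>S\<^esub>n\<in>A. h n) m = (\<Oplus>n\<in>A. h n m)"
  using assms
proof (induction A rule: finite_induct)
  case empty
  then show ?case by (simp add: zero_eq)
next
  case (insert a A)
  then have "(\<lambda>n. h n m) \<in> A \<rightarrow> carrier G" "h a m \<in> carrier G"
    using carrierD by (auto simp: Pi_iff)
  with insert show ?case
    by (simp add: add_eq)
qed

lemma additive_subgroup_homogeneous_part: "additive_subgroup (homogeneous_part G F n) S"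
proof (rule S.additive_subgroup_criterion)
  interpret F: additive_subgroup "F n" G by (rule additive_subgroup_component)
  show sub: "homogeneous_part G F n \<subseteq> carrier S"
    by (auto simp: homogeneous_part_def in_degree_closed)
  have "\<zero>\<^bsub>S\<^esub> = in_degree G n \<zero>"
    by (auto simp: zero_eq in_degree_def)
  then show "\<zero>\<^bsub>S\<^esub> \<in> homogeneous_part G F n"
    by (simp add: homogeneous_part_def)
  show "f \<oplus>\<^bsub>S\<^esub> g \<in> homogeneous_part G F n"
    if "f \<in> homogeneous_part G F n" "g \<in> homogeneous_part G F n" for f g
  proof -
    from that obtain x y where "x \<in> F n" "y \<in> F n" "f = in_degree G n x" "g = in_degree G n y"
      by (auto simp: homogeneous_part_def)
    moreover from this have "f \<oplus>\<^bsub>S\<^esub> g = in_degree G n (x \<oplus> y)"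
      by (auto simp: add_eq in_degree_def)
    ultimately show ?thesis by (auto simp: homogeneous_part_def)
  qed
  show "\<ominus>\<^bsub>S\<^esub> f \<in> homogeneous_part G F n" if f: "f \<in> homogeneous_part G F n" for f
  proof -
    from f obtain x where x: "x \<in> F n" "f = in_degree G n x"
      by (auto simp: homogeneous_part_def)
    then have "in_degree G n (\<ominus> x) \<oplus>\<^bsub>S\<^esub> f = \<zero>\<^bsub>S\<^esub>"
      by (auto simp: add_eq zero_eq in_degree_def l_neg component_subset)
    then have "\<ominus>\<^bsub>S\<^esub> f = in_degree G n (\<ominus> x)"
      using x by (intro S.minus_equality) (auto intro: in_degree_closed)
    then show ?thesis using x by (auto simp: homogeneous_part_def)
  qed
qed

text \<open>
  Evaluating a decomposition \<open>f = \<Sum>\<^sub>n h n\<close> at \<open>m\<close> leaves only the summand \<open>h m\<close>, since \<open>h n\<close> is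
  concentrated in degree \<open>n\<close>. Hence \<open>h m\<close> must be \<open>f m\<close> placed in degree \<open>m\<close>, and this choice works.
\<close>

lemma graded_by_homogeneous_parts: "graded_by S (homogeneous_part G F)"
  unfolding graded_by_def
proof (intro conjI allI ballI)
  show "additive_subgroup (homogeneous_part G F n) S" for n
    by (rule additive_subgroup_homogeneous_part)
  fix f assume f: "f \<in> carrier S"
  show "\<exists>!h. (\<forall>n. h n \<in> homogeneous_part G F n) \<and> finite {n. h n \<noteq> \<zero>\<^bsub>S\<^esub>} \<and>
          f = (\<Oplus>\<^bsub>S\<^esub>n\<in>{n. h n \<noteq> \<zero>\<^bsub>S\<^esub>}. h n)"
  proof (rule ex1I)
    let ?h = "\<lambda>n. in_degree G n (f n)"
    have in_S: "?h n \<in> carrier S" for n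
      by (rule in_degree_closed) (rule carrierD[OF f])
    have supp: "{n. ?h n \<noteq> \<zero>\<^bsub>S\<^esub>} = {n. f n \<noteq> \<zero>}"
      by (auto simp: in_degree_def zero_eq fun_eq_iff)
    have "f m = (\<Oplus>\<^bsub>S\<^esub>n\<in>{n. f n \<noteq> \<zero>}. ?h n) m" for m
    proof -
      have "(\<Oplus>\<^bsub>S\<^esub>n\<in>{n. f n \<noteq> \<zero>}. ?h n) m = (\<Oplus>n\<in>{n. f n \<noteq> \<zero>}. ?h n m)"
        using in_S carrierD(3)[OF f] by (intro finsum_apply) auto
      also have "\<dots> = (\<Oplus>n\<in>{n. f n \<noteq> \<zero>}. if m = n then f n else \<zero>)"
        by (rule finsum_cong') (use carrierD[OF f] in \<open>auto simp: in_degree_def\<close>)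
      also have "\<dots> = f m"
      proof (cases "f m = \<zero>")
        case True
        then have "(\<Oplus>n\<in>{n. f n \<noteq> \<zero>}. if m = n then f n else \<zero>) = (\<Oplus>n\<in>{n. f n \<noteq> \<zero>}. \<zero>)"
          by (intro finsum_cong') auto
        with True show ?thesis by simp
      next
        case False
        then show ?thesis
          using carrierD[OF f] by (intro add.finprod_singleton) auto
      qed
      finally show ?thesis by simp
    qed
    then have "f = (\<Oplus>\<^bsub>S\<^esub>n\<in>{n. f n \<noteq> \<zero>}. ?h n)"
      by (rule ext)
    moreover have "?h n \<in> homogeneous_part G F n" for n
      unfolding homogeneous_part_def by (rule imageI) (rule carrierD[OF f])
    ultimately show "(\<forall>n. ?h n \<in> homogeneous_part G F n) \<and> finite {n. ?h n \<noteq> \<zero>\<^bsub>S\<^esub>} \<and>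
          f = (\<Oplus>\<^bsub>S\<^esub>n\<in>{n. ?h n \<noteq> \<zero>\<^bsub>S\<^esub>}. ?h n)"
      unfolding supp using carrierD(3)[OF f] by blast
  next
    fix h
    assume h: "(\<forall>n. h n \<in> homogeneous_part G F n) \<and> finite {n. h n \<noteq> \<zero>\<^bsub>S\<^esub>} \<and>
          f = (\<Oplus>\<^bsub>S\<^esub>n\<in>{n. h n \<noteq> \<zero>\<^bsub>S\<^esub>}. h n)"
    let ?A = "{n. h n \<noteq> \<zero>\<^bsub>S\<^esub>}"
    have homog: "\<exists>x\<in>F n. h n = in_degree G n x" for n
      using h by (auto simp: homogeneous_part_def)
    then have diag: "h n = in_degree G n (h n n)" for n
      by (metis in_degree_def)
    have in_S: "h n \<in> carrier S" for n
      using homog in_degree_closed by metis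
    have "f m = h m m" for m
    proof -
      have "f m = (\<Oplus>\<^bsub>S\<^esub>n\<in>?A. h n) m"
        using h by (intro fun_cong[of f]) blast
      also have "\<dots> = (\<Oplus>n\<in>?A. h n m)"
        using h in_S by (intro finsum_apply) blast+
      also have "\<dots> = (\<Oplus>n\<in>?A. if m = n then h n n else \<zero>)"
      proof (rule finsum_cong')
        show "h n m = (if m = n then h n n else \<zero>)" for n
          using fun_cong[OF diag[of n], of m] by (simp add: in_degree_def)
      qed (use carrierD[OF in_S] in auto)
      also have "\<dots> = h m m"
      proof (cases "h m = \<zero>\<^bsub>S\<^esub>")
        case True
        then have "(\<Oplus>n\<in>?A. if m = n then h n n else \<zero>) = (\<Oplus>n\<in>?A. \<zero>)"
          by (intro finsum_cong') auto
        with True show ?thesis by (simp add: zero_eq)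
      next
        case False
        then show ?thesis
          using h carrierD[OF in_S] by (intro add.finprod_singleton) auto
      qed
      finally show ?thesis .
    qed
    then show "h = (\<lambda>n. in_degree G n (f n))"
      using diag by auto
  qed
qed

end

section \<open>Rees rings and Rees modules\<close>

text \<open>
  Both sides sum \<open>h i j\<close> over the triangle \<open>i + j \<le> n\<close>: on the left by the diagonals \<open>i + j = const\<close>,
  on the right by rows. Passing from \<open>n\<close> to \<open>n + 1\<close> adds one diagonal. This is the combinatorial
  content of the associativity of convolution.
\<close>

lemma (in abelian_monoid) finsum_triangle_swap:
  fixes n :: nat
  assumes h: "\<And>i j. h i j \<in> carrier G"
  shows "(\<Oplus>i\<in>{..n}. \<Oplus>j\<in>{..i}. h j (i - j)) = (\<Oplus>i\<in>{..n}. \<Oplus>j\<in>{..n - i}. h i j)"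
proof (induction n)
  case 0
  show ?case by (simp add: h)
next
  case (Suc n)
  have "(\<Oplus>i\<in>{..n}. \<Oplus>j\<in>{..Suc n - i}. h i j)
      = (\<Oplus>i\<in>{..n}. h i (Suc n - i) \<oplus> (\<Oplus>j\<in>{..n - i}. h i j))"
    by (rule finsum_cong') (auto simp: h Suc_diff_le)
  also have "\<dots> = (\<Oplus>i\<in>{..n}. h i (Suc n - i)) \<oplus> (\<Oplus>i\<in>{..n}. \<Oplus>j\<in>{..n - i}. h i j)"
    by (rule finsum_addf) (auto simp: h)
  finally show ?case
    using Suc.IH by (simp add: h a_assoc del: finsum_addf)
qed

lemma (in module) finsum_smult_rdistr:
  assumes "finite A" "f \<in> A \<rightarrow> carrier R" "x \<in> carrier M"
  shows "(\<Oplus>i\<in>A. f i) \<odot>\<^bsub>M\<^esub> x = (\<Oplus>\<^bsub>M\<^esub>i\<in>A. f i \<odot>\<^bsub>M\<^esub> x)"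
  using assms by (induction A rule: finite_induct) (simp_all add: Pi_iff smult_l_distr)

locale filtered_module = module +
  fixes F :: "nat \<Rightarrow> 'a set" and G :: "nat \<Rightarrow> 'c set"
  assumes ring_filtration: "additive_subgroup (F n) R"
    and one_filtration: "\<one> \<in> F 0"
    and mult_filtration: "\<lbrakk>a \<in> F m; b \<in> F n\<rbrakk> \<Longrightarrow> a \<otimes> b \<in> F (m + n)"
    and module_filtration: "additive_subgroup (G n) M"
    and smult_filtration: "\<lbrakk>a \<in> F m; x \<in> G n\<rbrakk> \<Longrightarrow> a \<odot>\<^bsub>M\<^esub> x \<in> G (m + n)"
begin

sublocale ring_sum: external_direct_sum R F "rees_ring R F"
  by (intro external_direct_sum.intro external_direct_sum_axioms.intro)
     (simp_all add: R.abelian_group_axioms ring_filtration rees_ring_def)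

sublocale module_sum: external_direct_sum M G "rees_module M G"
  by (intro external_direct_sum.intro external_direct_sum_axioms.intro)
     (simp_all add: M.abelian_group_axioms module_filtration rees_module_def)

lemma smult_apply:
  "(f \<odot>\<^bsub>rees_module M G\<^esub> u) n = (\<Oplus>\<^bsub>M\<^esub>i\<in>{..n}. f i \<odot>\<^bsub>M\<^esub> u (n - i))"
  by (simp add: rees_module_def)

lemma rees_smult_closed:
  assumes f: "f \<in> carrier (rees_ring R F)" and u: "u \<in> carrier (rees_module M G)"
  shows "f \<odot>\<^bsub>rees_module M G\<^esub> u \<in> carrier (rees_module M G)"
proof (rule module_sum.carrierI)
  note f' = ring_sum.carrierD[OF f] and u' = module_sum.carrierD[OF u]
  show "(f \<odot>\<^bsub>rees_module M G\<^esub> u) n \<in> G n" for n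
    unfolding smult_apply
  proof (rule M.finsum_mem_additive_subgroup[OF module_filtration])
    show "f i \<odot>\<^bsub>M\<^esub> u (n - i) \<in> G n" if "i \<in> {..n}" for i
      using smult_filtration[OF f'(1) u'(1), of i "n - i"] that by simp
  qed simp
  \<comment> \<open>The support of a convolution lies in the sumset of the two supports.\<close>
  have "{n. (f \<odot>\<^bsub>rees_module M G\<^esub> u) n \<noteq> \<zero>\<^bsub>M\<^esub>}
      \<subseteq> (\<lambda>(i, j). i + j) ` ({i. f i \<noteq> \<zero>} \<times> {j. u j \<noteq> \<zero>\<^bsub>M\<^esub>})"
  proof (rule subsetI, rule ccontr)
    fix n
    assume n: "n \<in> {n. (f \<odot>\<^bsub>rees_module M G\<^esub> u) n \<noteq> \<zero>\<^bsub>M\<^esub>}"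
      and out: "n \<notin> (\<lambda>(i, j). i + j) ` ({i. f i \<noteq> \<zero>} \<times> {j. u j \<noteq> \<zero>\<^bsub>M\<^esub>})"
    have "f i \<odot>\<^bsub>M\<^esub> u (n - i) = \<zero>\<^bsub>M\<^esub>" if "i \<le> n" for i
    proof -
      have "f i = \<zero> \<or> u (n - i) = \<zero>\<^bsub>M\<^esub>"
        using out that by (force simp: image_iff)
      then show ?thesis using f'(2) u'(2) by auto
    qed
    then have "(\<Oplus>\<^bsub>M\<^esub>i\<in>{..n}. f i \<odot>\<^bsub>M\<^esub> u (n - i)) = (\<Oplus>\<^bsub>M\<^esub>i\<in>{..n}. \<zero>\<^bsub>M\<^esub>)"
      by (intro M.finsum_cong') auto
    with n show False by (simp add: smult_apply)
  qed
  then show "finite {n. (f \<odot>\<^bsub>rees_module M G\<^esub> u) n \<noteq> \<zero>\<^bsub>M\<^esub>}"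
    by (rule finite_subset) (use f' u' in auto)
qed

lemma rees_smult_l_distr:
  assumes f: "f \<in> carrier (rees_ring R F)" and g: "g \<in> carrier (rees_ring R F)"
    and u: "u \<in> carrier (rees_module M G)"
  shows "(f \<oplus>\<^bsub>rees_ring R F\<^esub> g) \<odot>\<^bsub>rees_module M G\<^esub> u
    = f \<odot>\<^bsub>rees_module M G\<^esub> u \<oplus>\<^bsub>rees_module M G\<^esub> g \<odot>\<^bsub>rees_module M G\<^esub> u"
proof
  fix n
  note [simp] = ring_sum.carrierD(2)[OF f] ring_sum.carrierD(2)[OF g] module_sum.carrierD(2)[OF u]
  show "((f \<oplus>\<^bsub>rees_ring R F\<^esub> g) \<odot>\<^bsub>rees_module M G\<^esub> u) n
    = (f \<odot>\<^bsub>rees_module M G\<^esub> u \<oplus>\<^bsub>rees_module M G\<^esub> g \<odot>\<^bsub>rees_module M G\<^esub> u) n"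
    by (simp add: smult_apply ring_sum.add_eq module_sum.add_eq smult_l_distr)
qed

lemma rees_smult_r_distr:
  assumes f: "f \<in> carrier (rees_ring R F)" and u: "u \<in> carrier (rees_module M G)"
    and v: "v \<in> carrier (rees_module M G)"
  shows "f \<odot>\<^bsub>rees_module M G\<^esub> (u \<oplus>\<^bsub>rees_module M G\<^esub> v)
    = f \<odot>\<^bsub>rees_module M G\<^esub> u \<oplus>\<^bsub>rees_module M G\<^esub> f \<odot>\<^bsub>rees_module M G\<^esub> v"
proof
  fix n
  note [simp] = ring_sum.carrierD(2)[OF f] module_sum.carrierD(2)[OF u] module_sum.carrierD(2)[OF v]
  show "(f \<odot>\<^bsub>rees_module M G\<^esub> (u \<oplus>\<^bsub>rees_module M G\<^esub> v)) n
    = (f \<odot>\<^bsub>rees_module M G\<^esub> u \<oplus>\<^bsub>rees_module M G\<^esub> f \<odot>\<^bsub>rees_module M G\<^esub> v) n"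
    by (simp add: smult_apply module_sum.add_eq smult_r_distr)
qed

lemma rees_smult_assoc:
  assumes f: "f \<in> carrier (rees_ring R F)" and g: "g \<in> carrier (rees_ring R F)"
    and u: "u \<in> carrier (rees_module M G)"
  shows "(f \<otimes>\<^bsub>rees_ring R F\<^esub> g) \<odot>\<^bsub>rees_module M G\<^esub> u
    = f \<odot>\<^bsub>rees_module M G\<^esub> (g \<odot>\<^bsub>rees_module M G\<^esub> u)"
proof
  fix n
  note [simp] = ring_sum.carrierD(2)[OF f] ring_sum.carrierD(2)[OF g] module_sum.carrierD(2)[OF u]
  have "((f \<otimes>\<^bsub>rees_ring R F\<^esub> g) \<odot>\<^bsub>rees_module M G\<^esub> u) n
      = (\<Oplus>\<^bsub>M\<^esub>i\<in>{..n}. (\<Oplus>j\<in>{..i}. f j \<otimes> g (i - j)) \<odot>\<^bsub>M\<^esub> u (n - i))"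
    by (simp add: smult_apply rees_ring_def)
  \<comment> \<open>Writing \<open>n - i\<close> as \<open>n - (j + (i - j))\<close> exhibits the summand as a function of \<open>j\<close> and \<open>i - j\<close>,
      the form required by the interchange of the sums.\<close>
  also have "\<dots> = (\<Oplus>\<^bsub>M\<^esub>i\<in>{..n}. \<Oplus>\<^bsub>M\<^esub>j\<in>{..i}. (f j \<otimes> g (i - j)) \<odot>\<^bsub>M\<^esub> u (n - (j + (i - j))))"
    by (rule M.finsum_cong')
       (auto simp: finsum_smult_rdistr intro!: M.finsum_cong')
  also have "\<dots> = (\<Oplus>\<^bsub>M\<^esub>i\<in>{..n}. \<Oplus>\<^bsub>M\<^esub>j\<in>{..n - i}. (f i \<otimes> g j) \<odot>\<^bsub>M\<^esub> u (n - (i + j)))"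
    by (rule M.finsum_triangle_swap) simp
  also have "\<dots> = (\<Oplus>\<^bsub>M\<^esub>i\<in>{..n}. f i \<odot>\<^bsub>M\<^esub> (\<Oplus>\<^bsub>M\<^esub>j\<in>{..n - i}. g j \<odot>\<^bsub>M\<^esub> u (n - i - j)))"
    by (rule M.finsum_cong')
       (auto simp: finsum_smult_ldistr smult_assoc1)
  also have "\<dots> = (f \<odot>\<^bsub>rees_module M G\<^esub> (g \<odot>\<^bsub>rees_module M G\<^esub> u)) n"
    by (simp add: smult_apply)
  finally show "((f \<otimes>\<^bsub>rees_ring R F\<^esub> g) \<odot>\<^bsub>rees_module M G\<^esub> u) n
      = (f \<odot>\<^bsub>rees_module M G\<^esub> (g \<odot>\<^bsub>rees_module M G\<^esub> u)) n" .
qed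

lemma in_degree_smult:
  assumes a: "a \<in> F m" and x: "x \<in> G n"
  shows "in_degree R m a \<odot>\<^bsub>rees_module M G\<^esub> in_degree M n x = in_degree M (m + n) (a \<odot>\<^bsub>M\<^esub> x)"
proof
  fix k
  have [simp]: "a \<in> carrier R" "x \<in> carrier M"
    using a x ring_sum.component_subset module_sum.component_subset by auto
  have "(in_degree R m a \<odot>\<^bsub>rees_module M G\<^esub> in_degree M n x) k
      = (\<Oplus>\<^bsub>M\<^esub>i\<in>{..k}. if m = i then a \<odot>\<^bsub>M\<^esub> in_degree M n x (k - i) else \<zero>\<^bsub>M\<^esub>)"
    unfolding smult_apply by (rule M.finsum_cong') (auto simp: in_degree_def)
  also have "\<dots> = in_degree M (m + n) (a \<odot>\<^bsub>M\<^esub> x) k"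
  proof (cases "m \<le> k")
    case True
    then have "(\<Oplus>\<^bsub>M\<^esub>i\<in>{..k}. if m = i then a \<odot>\<^bsub>M\<^esub> in_degree M n x (k - i) else \<zero>\<^bsub>M\<^esub>)
        = a \<odot>\<^bsub>M\<^esub> in_degree M n x (k - m)"
      by (intro M.add.finprod_singleton) (auto simp: in_degree_def)
    with True show ?thesis by (auto simp: in_degree_def)
  next
    case False
    then have "(\<Oplus>\<^bsub>M\<^esub>i\<in>{..k}. if m = i then a \<odot>\<^bsub>M\<^esub> in_degree M n x (k - i) else \<zero>\<^bsub>M\<^esub>)
        = (\<Oplus>\<^bsub>M\<^esub>i\<in>{..k}. \<zero>\<^bsub>M\<^esub>)"
      by (intro M.finsum_cong') auto
    with False show ?thesis by (auto simp: in_degree_def)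
  qed
  finally show "(in_degree R m a \<odot>\<^bsub>rees_module M G\<^esub> in_degree M n x) k
      = in_degree M (m + n) (a \<odot>\<^bsub>M\<^esub> x) k" .
qed

lemma homogeneous_part_smult:
  assumes "f \<in> homogeneous_part R F m" "u \<in> homogeneous_part M G n"
  shows "f \<odot>\<^bsub>rees_module M G\<^esub> u \<in> homogeneous_part M G (m + n)"
  using assms by (auto simp: homogeneous_part_def in_degree_smult smult_filtration)

lemma rees_smult_one:
  assumes u: "u \<in> carrier (rees_module M G)"
  shows "\<one>\<^bsub>rees_ring R F\<^esub> \<odot>\<^bsub>rees_module M G\<^esub> u = u"
proof
  fix n
  note [simp] = module_sum.carrierD(2)[OF u]
  have "(\<one>\<^bsub>rees_ring R F\<^esub> \<odot>\<^bsub>rees_module M G\<^esub> u) n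
      = (\<Oplus>\<^bsub>M\<^esub>i\<in>{..n}. if 0 = i then u (n - i) else \<zero>\<^bsub>M\<^esub>)"
    unfolding smult_apply by (rule M.finsum_cong') (auto simp: rees_ring_def in_degree_def)
  also have "\<dots> = u (n - 0)"
    by (rule M.add.finprod_singleton) auto
  finally show "(\<one>\<^bsub>rees_ring R F\<^esub> \<odot>\<^bsub>rees_module M G\<^esub> u) n = u n" by simp
qed

end

text \<open>
  With the ring viewed as a module over itself, the convolution product of the Rees ring is
  literally the scalar multiplication of a Rees module, and the laws proved above for the action
  become laws of the ring.
\<close>

definition regular_module :: "('a, 'r) ring_scheme \<Rightarrow> ('a, 'a) module"
  where "regular_module R = \<lparr>carrier = carrier R, monoid.mult = monoid.mult R, one = \<one>\<^bsub>R\<^esub>,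
    ring.zero = \<zero>\<^bsub>R\<^esub>, add = add R, smult = monoid.mult R\<rparr>"

lemma finsum_regular_module: "finsum (regular_module R) = finsum R"
  by (simp add: finsum_def finprod_def regular_module_def fun_eq_iff)

lemma in_degree_regular_module: "in_degree (regular_module R) = in_degree R"
  by (simp add: in_degree_def regular_module_def fun_eq_iff)

lemma homogeneous_part_regular_module: "homogeneous_part (regular_module R) = homogeneous_part R"
  by (simp add: homogeneous_part_def in_degree_regular_module fun_eq_iff)

lemma additive_subgroup_regular_module:
  "additive_subgroup H (regular_module R) \<longleftrightarrow> additive_subgroup H R"
  by (simp add: additive_subgroup_def subgroup_def m_inv_def regular_module_def)

lemma (in cring) module_regular_module: "module R (regular_module R)"
proof (rule moduleI)
  show "abelian_group (regular_module R)"
    using abelian_groupE[OF is_abelian_group]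
    by (intro abelian_groupI) (simp_all add: regular_module_def)
qed (simp_all add: regular_module_def is_cring l_distr r_distr m_assoc)

lemma rees_module_regular_module:
  "carrier (rees_module (regular_module R) F) = carrier (rees_ring R F)"
  "add (rees_module (regular_module R) F) = add (rees_ring R F)"
  "smult (rees_module (regular_module R) F) = monoid.mult (rees_ring R F)"
  by (simp_all add: rees_module_def rees_ring_def finsum_regular_module)
     (simp_all add: regular_module_def direct_sum_carrier_def)

context filtered_module
begin

lemma filtered_regular_module: "filtered_module R (regular_module R) F F"
proof (intro filtered_module.intro filtered_module_axioms.intro)
  show "a \<odot>\<^bsub>regular_module R\<^esub> b \<in> F (m + n)" if "a \<in> F m" "b \<in> F n" for a b m n
    using mult_filtration[OF that] by (simp add: regular_module_def)
qed (simp_all add: R.module_regular_module ring_filtration one_filtration mult_filtration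
       additive_subgroup_regular_module)

interpretation regular: filtered_module R "regular_module R" F F
  by (rule filtered_regular_module)

text \<open>The reflection \<open>i \<mapsto> n - i\<close> exchanges the two factors of the convolution.\<close>

lemma rees_mult_comm:
  assumes f: "f \<in> carrier (rees_ring R F)" and g: "g \<in> carrier (rees_ring R F)"
  shows "f \<otimes>\<^bsub>rees_ring R F\<^esub> g = g \<otimes>\<^bsub>rees_ring R F\<^esub> f"
proof
  fix n :: nat
  note [simp] = ring_sum.carrierD(2)[OF f] ring_sum.carrierD(2)[OF g]
  have "i \<in> (\<lambda>i. n - i) ` {..n}" if "i \<le> n" for i
    using that by (intro image_eqI[of _ _ "n - i"]) auto
  then have "inj_on (\<lambda>i. n - i) {..n}" "(\<lambda>i. n - i) ` {..n} = {..n}"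
    by (auto simp: inj_on_def)
  then have "(\<Oplus>i\<in>{..n}. f i \<otimes> g (n - i)) = (\<Oplus>i\<in>{..n}. f (n - i) \<otimes> g (n - (n - i)))"
    using R.add.finprod_reindex[of "\<lambda>i. f i \<otimes> g (n - i)" "\<lambda>i. n - i" "{..n}"] by simp
  also have "\<dots> = (\<Oplus>i\<in>{..n}. g i \<otimes> f (n - i))"
    by (rule R.finsum_cong') (auto simp: R.m_comm)
  finally show "(f \<otimes>\<^bsub>rees_ring R F\<^esub> g) n = (g \<otimes>\<^bsub>rees_ring R F\<^esub> f) n"
    by (simp add: rees_ring_def)
qed

lemma cring_rees_ring: "cring (rees_ring R F)"
proof (rule cringI)
  note regular_rules = rees_module_regular_module
  show "abelian_group (rees_ring R F)"
    by (rule ring_sum.abelian_group_sum)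
  show "comm_monoid (rees_ring R F)"
  proof (rule comm_monoidI)
    show "\<one>\<^bsub>rees_ring R F\<^esub> \<in> carrier (rees_ring R F)"
      using ring_sum.in_degree_closed[OF one_filtration] by (simp add: rees_ring_def)
  qed (use regular.rees_smult_closed regular.rees_smult_assoc regular.rees_smult_one rees_mult_comm
       in \<open>simp_all add: regular_rules\<close>)
  show "(f \<oplus>\<^bsub>rees_ring R F\<^esub> g) \<otimes>\<^bsub>rees_ring R F\<^esub> h
      = f \<otimes>\<^bsub>rees_ring R F\<^esub> h \<oplus>\<^bsub>rees_ring R F\<^esub> g \<otimes>\<^bsub>rees_ring R F\<^esub> h"
    if "f \<in> carrier (rees_ring R F)" "g \<in> carrier (rees_ring R F)" "h \<in> carrier (rees_ring R F)"
    for f g h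
    using regular.rees_smult_l_distr[of f g h] that by (simp add: regular_rules)
qed

lemma homogeneous_part_mult:
  assumes "f \<in> homogeneous_part R F m" "g \<in> homogeneous_part R F n"
  shows "f \<otimes>\<^bsub>rees_ring R F\<^esub> g \<in> homogeneous_part R F (m + n)"
  using regular.homogeneous_part_smult[of f m g n] assms
  unfolding rees_module_regular_module homogeneous_part_regular_module by blast

lemma graded_ring_rees_ring: "graded_ring (rees_ring R F) (homogeneous_part R F)"
  by (intro graded_ring.intro graded_ring_axioms.intro)
     (rule cring.axioms(1)[OF cring_rees_ring] ring_sum.graded_by_homogeneous_parts
       homogeneous_part_mult | assumption)+

lemma module_rees_module: "module (rees_ring R F) (rees_module M G)"
  by (rule moduleI)
     (rule cring_rees_ring module_sum.abelian_group_sum rees_smult_closed rees_smult_l_distr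
       rees_smult_r_distr rees_smult_assoc rees_smult_one | assumption)+

lemma graded_module_rees_module:
  "graded_module (rees_ring R F) (homogeneous_part R F) (rees_module M G) (homogeneous_part M G)"
  by (intro graded_module.intro graded_module_axioms.intro)
     (rule graded_ring_rees_ring module_rees_module module_sum.graded_by_homogeneous_parts
       homogeneous_part_smult | assumption)+

end

section \<open>Multiplication of submodules by ideals\<close>

context module
begin

lemma submodule_generated_submodule:
  assumes "A \<subseteq> carrier M"
  shows "submodule (generated_submodule R M A) R M"
proof (rule submoduleI)
  have carrier: "carrier M \<in> {N. submodule N R M \<and> A \<subseteq> N}"
    using carrier_is_submodule assms by simp
  then show "generated_submodule R M A \<subseteq> carrier M"
    unfolding generated_submodule_def by (rule Inter_lower)
  show "\<zero>\<^bsub>M\<^esub> \<in> generated_submodule R M A"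
    unfolding generated_submodule_def
    using subgroup.one_closed submodule.axioms(1) by force
qed (auto simp: generated_submodule_def submoduleE)

lemma generated_submodule_least:
  "\<lbrakk>submodule N R M; A \<subseteq> N\<rbrakk> \<Longrightarrow> generated_submodule R M A \<subseteq> N"
  by (auto simp: generated_submodule_def)

lemma generated_submodule_incl: "A \<subseteq> generated_submodule R M A"
  by (auto simp: generated_submodule_def)

lemma submodule_ideal_smult:
  assumes "L \<subseteq> carrier R" "N \<subseteq> carrier M"
  shows "submodule (ideal_smult R M L N) R M"
  unfolding ideal_smult_def using assms by (intro submodule_generated_submodule) auto

lemma smult_mem_ideal_smult: "\<lbrakk>a \<in> L; x \<in> N\<rbrakk> \<Longrightarrow> a \<odot>\<^bsub>M\<^esub> x \<in> ideal_smult R M L N"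
  unfolding ideal_smult_def by (rule subsetD[OF generated_submodule_incl]) blast

lemma ideal_smult_least:
  assumes "submodule K R M" "\<And>a x. \<lbrakk>a \<in> L; x \<in> N\<rbrakk> \<Longrightarrow> a \<odot>\<^bsub>M\<^esub> x \<in> K"
  shows "ideal_smult R M L N \<subseteq> K"
  unfolding ideal_smult_def using assms by (intro generated_submodule_least) auto

text \<open>
  Because \<open>R\<close> is commutative, multiplication by \<open>a\<close> is linear. Inclusions \<open>a K \<subseteq> N\<close> for a generated
  submodule \<open>K\<close> therefore need only be checked on generators.
\<close>

lemma submodule_vimage_smult:
  assumes N: "submodule N R M" and a: "a \<in> carrier R"
  shows "submodule {x \<in> carrier M. a \<odot>\<^bsub>M\<^esub> x \<in> N} R M"
proof (rule submoduleI)
  note N' = submoduleE[OF N]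
  show "\<zero>\<^bsub>M\<^esub> \<in> {x \<in> carrier M. a \<odot>\<^bsub>M\<^esub> x \<in> N}"
    using a subgroup.one_closed[OF submodule.axioms(1)[OF N]] by simp
  show "b \<odot>\<^bsub>M\<^esub> x \<in> {x \<in> carrier M. a \<odot>\<^bsub>M\<^esub> x \<in> N}"
    if "b \<in> carrier R" "x \<in> {x \<in> carrier M. a \<odot>\<^bsub>M\<^esub> x \<in> N}" for b x
  proof -
    have "a \<odot>\<^bsub>M\<^esub> (b \<odot>\<^bsub>M\<^esub> x) = b \<odot>\<^bsub>M\<^esub> (a \<odot>\<^bsub>M\<^esub> x)"
      using a that by (simp flip: smult_assoc1 add: R.m_comm)
    with that N' show ?thesis by simp
  qed
qed (use a submoduleE[OF N] in \<open>auto simp: smult_r_distr smult_r_minus\<close>)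

text \<open>
  An element \<open>c\<close> of \<open>LK\<close> is a sum of products, so \<open>c x\<close> is handled by induction on \<open>c\<close>. Conversely,
  \<open>a y\<close> with \<open>a \<in> L\<close> lies in \<open>(LK)N\<close> for all \<open>y \<in> KN\<close> as soon as it does for \<open>y = b x\<close> with
  \<open>b \<in> K\<close> and \<open>x \<in> N\<close>.
\<close>

lemma ideal_smult_ideal_prod:
  assumes L: "ideal L R" and K: "ideal K R" and N: "N \<subseteq> carrier M"
  shows "ideal_smult R M (L \<cdot>\<^bsub>R\<^esub> K) N = ideal_smult R M L (ideal_smult R M K N)"
proof
  have Lc: "L \<subseteq> carrier R" and Kc: "K \<subseteq> carrier R"
    using L K by (auto dest: ideal.Icarr)
  have LKc: "L \<cdot>\<^bsub>R\<^esub> K \<subseteq> carrier R"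
    by (rule R.ideal_prod_in_carrier[OF L K])
  have KN: "submodule (ideal_smult R M K N) R M"
    by (rule submodule_ideal_smult[OF Kc N])
  have KNc: "ideal_smult R M K N \<subseteq> carrier M"
    by (rule submoduleE(1)[OF KN])
  have LKN: "submodule (ideal_smult R M L (ideal_smult R M K N)) R M"
    by (rule submodule_ideal_smult[OF Lc KNc])
  have LKN': "submodule (ideal_smult R M (L \<cdot>\<^bsub>R\<^esub> K) N) R M"
    by (rule submodule_ideal_smult[OF LKc N])
  show "ideal_smult R M (L \<cdot>\<^bsub>R\<^esub> K) N \<subseteq> ideal_smult R M L (ideal_smult R M K N)"
  proof (rule ideal_smult_least[OF LKN])
    fix c x assume c: "c \<in> L \<cdot>\<^bsub>R\<^esub> K" and x: "x \<in> N"
    from c show "c \<odot>\<^bsub>M\<^esub> x \<in> ideal_smult R M L (ideal_smult R M K N)"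
    proof induction
      case (prod a b)
      have "(a \<otimes> b) \<odot>\<^bsub>M\<^esub> x = a \<odot>\<^bsub>M\<^esub> (b \<odot>\<^bsub>M\<^esub> x)"
        using prod x Lc Kc N by (intro smult_assoc1) auto
      with prod x show ?case by (simp add: smult_mem_ideal_smult)
    next
      case (sum s t)
      then have "(s \<oplus> t) \<odot>\<^bsub>M\<^esub> x = s \<odot>\<^bsub>M\<^esub> x \<oplus>\<^bsub>M\<^esub> t \<odot>\<^bsub>M\<^esub> x"
        using x LKc N by (intro smult_l_distr) auto
      with sum show ?case using submoduleE(5)[OF LKN] by simp
    qed
  qed
  show "ideal_smult R M L (ideal_smult R M K N) \<subseteq> ideal_smult R M (L \<cdot>\<^bsub>R\<^esub> K) N"
  proof (rule ideal_smult_least[OF LKN'])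
    fix a y assume a: "a \<in> L" and y: "y \<in> ideal_smult R M K N"
    have "ideal_smult R M K N \<subseteq> {x \<in> carrier M. a \<odot>\<^bsub>M\<^esub> x \<in> ideal_smult R M (L \<cdot>\<^bsub>R\<^esub> K) N}"
    proof (rule ideal_smult_least[OF submodule_vimage_smult[OF LKN']])
      fix b x assume bx: "b \<in> K" "x \<in> N"
      have "a \<odot>\<^bsub>M\<^esub> (b \<odot>\<^bsub>M\<^esub> x) = (a \<otimes> b) \<odot>\<^bsub>M\<^esub> x"
        using a bx Lc Kc N by (intro smult_assoc1[symmetric]) auto
      moreover have "a \<otimes> b \<in> L \<cdot>\<^bsub>R\<^esub> K"
        using a bx by (intro ideal_prod.prod)
      ultimately show "b \<odot>\<^bsub>M\<^esub> x \<in> {x \<in> carrier M. a \<odot>\<^bsub>M\<^esub> x \<in> ideal_smult R M (L \<cdot>\<^bsub>R\<^esub> K) N}"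
        using bx Kc N by (auto simp: smult_mem_ideal_smult)
    qed (use a Lc in auto)
    with y show "a \<odot>\<^bsub>M\<^esub> y \<in> ideal_smult R M (L \<cdot>\<^bsub>R\<^esub> K) N" by auto
  qed
qed

end

section \<open>Ratliff-Rush filtrations\<close>

locale module_with_ideal = module +
  fixes I
  assumes ideal_I: "ideal I R"
begin

text \<open>The \<open>I\<close>-adic filtration of \<open>M\<close>.\<close>

abbreviation adic :: "nat \<Rightarrow> 'c set"
  where "adic k \<equiv> ideal_smult R M (ideal_power R I k) (carrier M)"

sublocale ideals: comm_monoid "ideals_set R"
  by (rule R.ideals_set_is_comm_monoid)

lemma I_in_ideals_set: "I \<in> carrier (ideals_set R)"
  using ideal_I by (simp add: ideals_set_def)

lemma ideal_power_is_ideal: "ideal (ideal_power R I k) R"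
  using ideals.nat_pow_closed[OF I_in_ideals_set] by (simp add: ideals_set_def)

lemma ideal_power_subset: "a \<in> ideal_power R I k \<Longrightarrow> a \<in> carrier R"
  by (rule ideal.Icarr[OF ideal_power_is_ideal])

lemma ideal_power_add: "ideal_power R I (j + k) = ideal_power R I j \<cdot>\<^bsub>R\<^esub> ideal_power R I k"
  using ideals.nat_pow_mult[OF I_in_ideals_set, of j k] by (simp add: ideals_set_def)

lemma ideal_power_ideal_power: "ideal_power R (ideal_power R I n) k = ideal_power R I (n * k)"
  by (rule ideals.nat_pow_pow[OF I_in_ideals_set])

lemma submodule_adic: "submodule (adic k) R M"
  using ideal_power_subset by (intro submodule_ideal_smult) auto

lemma adic_subset: "x \<in> adic k \<Longrightarrow> x \<in> carrier M"
  using submoduleE(1)[OF submodule_adic] by blast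

lemma adic_zero: "\<zero>\<^bsub>M\<^esub> \<in> adic k"
  using subgroup.one_closed[OF submodule.axioms(1)[OF submodule_adic]] by simp

lemma adic_add: "adic (j + k) = ideal_smult R M (ideal_power R I j) (adic k)"
  by (simp add: ideal_power_add ideal_smult_ideal_prod ideal_power_is_ideal)

lemma smult_ideal_power_adic: "\<lbrakk>a \<in> ideal_power R I j; x \<in> adic k\<rbrakk> \<Longrightarrow> a \<odot>\<^bsub>M\<^esub> x \<in> adic (j + k)"
  by (simp only: adic_add smult_mem_ideal_smult)

text \<open>
  For \<open>b \<in> I\<^sup>j\<close> and \<open>x \<in> I\<^sup>k M\<close> the element \<open>a (b x) = b (a x)\<close> lies in \<open>I\<^sup>j I\<^sup>n\<^sup>+\<^sup>k M\<close>, and the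
  elements \<open>b x\<close> generate \<open>I\<^sup>j\<^sup>+\<^sup>k M\<close>. This and its analogue for \<open>colon_submodule\<close> say that the
  unions defining the two closures are ascending.
\<close>

lemma colon_ideal_adic_mono:
  assumes a: "a \<in> colon_ideal R M (adic (n + k)) (adic k)"
  shows "a \<in> colon_ideal R M (adic (n + (j + k))) (adic (j + k))"
proof -
  from a have aR: "a \<in> carrier R" and a: "\<And>x. x \<in> adic k \<Longrightarrow> a \<odot>\<^bsub>M\<^esub> x \<in> adic (n + k)"
    by (auto simp: colon_ideal_def)
  have "adic (j + k) \<subseteq> {y \<in> carrier M. a \<odot>\<^bsub>M\<^esub> y \<in> adic (n + (j + k))}"
    unfolding adic_add[of j k]
  proof (rule ideal_smult_least[OF submodule_vimage_smult[OF submodule_adic aR]])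
    fix b x assume b: "b \<in> ideal_power R I j" and x: "x \<in> adic k"
    have bx: "b \<in> carrier R" "x \<in> carrier M"
      using b x by (auto intro: ideal_power_subset adic_subset)
    have "a \<odot>\<^bsub>M\<^esub> (b \<odot>\<^bsub>M\<^esub> x) = b \<odot>\<^bsub>M\<^esub> (a \<odot>\<^bsub>M\<^esub> x)"
      using aR bx by (simp flip: smult_assoc1 add: R.m_comm)
    also have "\<dots> \<in> adic (j + (n + k))"
      by (rule smult_ideal_power_adic[OF b a[OF x]])
    finally show "b \<odot>\<^bsub>M\<^esub> x \<in> {y \<in> carrier M. a \<odot>\<^bsub>M\<^esub> y \<in> adic (n + (j + k))}"
      using bx by (simp add: add.left_commute)
  qed
  with aR show ?thesis by (auto simp: colon_ideal_def)
qed

lemma colon_submodule_adic_mono: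
  assumes z: "z \<in> colon_submodule M (adic (n + k)) (ideal_power R I k)"
  shows "z \<in> colon_submodule M (adic (n + (j + k))) (ideal_power R I (j + k))"
proof -
  from z have zM: "z \<in> carrier M" and z: "\<And>a. a \<in> ideal_power R I k \<Longrightarrow> a \<odot>\<^bsub>M\<^esub> z \<in> adic (n + k)"
    by (auto simp: colon_submodule_def)
  have "c \<odot>\<^bsub>M\<^esub> z \<in> adic (n + (j + k))" if "c \<in> ideal_power R I j \<cdot>\<^bsub>R\<^esub> ideal_power R I k" for c
    using that
  proof induction
    case (prod b a)
    have "(b \<otimes> a) \<odot>\<^bsub>M\<^esub> z = b \<odot>\<^bsub>M\<^esub> (a \<odot>\<^bsub>M\<^esub> z)"
      using prod zM by (intro smult_assoc1) (auto intro: ideal_power_subset)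
    also have "\<dots> \<in> adic (j + (n + k))"
      by (rule smult_ideal_power_adic[OF prod(1) z[OF prod(2)]])
    finally show ?case by (simp add: add.left_commute)
  next
    case (sum s t)
    then have "(s \<oplus> t) \<odot>\<^bsub>M\<^esub> z = s \<odot>\<^bsub>M\<^esub> z \<oplus>\<^bsub>M\<^esub> t \<odot>\<^bsub>M\<^esub> z"
      using zM R.ideal_prod_in_carrier[OF ideal_power_is_ideal ideal_power_is_ideal]
      by (intro smult_l_distr) auto
    with sum show ?case using submoduleE(5)[OF submodule_adic] by simp
  qed
  with zM show ?thesis by (auto simp: colon_submodule_def ideal_power_add)
qed

lemma adic_0: "adic 0 = carrier M"
proof
  show "adic 0 \<subseteq> carrier M" using adic_subset by blast
  show "carrier M \<subseteq> adic 0"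
  proof
    fix x assume "x \<in> carrier M"
    then have "\<one> \<odot>\<^bsub>M\<^esub> x \<in> adic 0"
      by (intro smult_mem_ideal_smult) (auto simp: ideals_set_def)
    with \<open>x \<in> carrier M\<close> show "x \<in> adic 0" by simp
  qed
qed

lemma r_filtration_eq: "r_filtration R M I n
    = (\<Union>k\<in>{1..}. colon_ideal R M (adic (n + n * k)) (adic (n * k)))"
  unfolding r_ideal_def ideal_power_ideal_power by simp

lemma ratliff_rush_filtration_eq: "ratliff_rush_filtration R M I n
    = (\<Union>k\<in>{1..}. colon_submodule M (adic (n + n * k)) (ideal_power R I (n * k)))"
  unfolding ratliff_rush_def ideal_power_ideal_power by simp

text \<open>
  The characterisation by all large \<open>k\<close> decouples \<open>k\<close> from \<open>n\<close>, which makes elements of different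
  degrees comparable. In the direction from right to left a large multiple of \<open>n\<close> is needed; there
  is none for \<open>n = 0\<close>, where instead \<open>r(I\<^sup>0, M) = R\<close> because every \<open>a\<close> satisfies \<open>a M \<subseteq> M\<close>.
\<close>

lemma mem_r_filtration_iff:
  "a \<in> r_filtration R M I n \<longleftrightarrow> a \<in> carrier R \<and>
    (\<forall>\<^sub>F k in sequentially. \<forall>x\<in>adic k. a \<odot>\<^bsub>M\<^esub> x \<in> adic (n + k))"
proof
  assume "a \<in> r_filtration R M I n"
  then obtain k where k: "a \<in> colon_ideal R M (adic (n + n * k)) (adic (n * k))"
    by (auto simp: r_filtration_eq)
  have "\<forall>x\<in>adic i. a \<odot>\<^bsub>M\<^esub> x \<in> adic (n + i)" if "i \<ge> n * k" for i
    using colon_ideal_adic_mono[OF k, of "i - n * k"] that by (auto simp: colon_ideal_def)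
  then have "\<forall>\<^sub>F i in sequentially. \<forall>x\<in>adic i. a \<odot>\<^bsub>M\<^esub> x \<in> adic (n + i)"
    by (auto simp: eventually_sequentially)
  with k show "a \<in> carrier R \<and> (\<forall>\<^sub>F i in sequentially. \<forall>x\<in>adic i. a \<odot>\<^bsub>M\<^esub> x \<in> adic (n + i))"
    by (auto simp: colon_ideal_def)
next
  assume rhs: "a \<in> carrier R \<and> (\<forall>\<^sub>F k in sequentially. \<forall>x\<in>adic k. a \<odot>\<^bsub>M\<^esub> x \<in> adic (n + k))"
  then have aR: "a \<in> carrier R" by simp
  show "a \<in> r_filtration R M I n"
  proof (cases "n = 0")
    case True
    have "a \<in> colon_ideal R M (adic (n + n * 1)) (adic (n * 1))"
      using True aR adic_0 by (simp add: colon_ideal_def)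
    then show ?thesis unfolding r_filtration_eq by blast
  next
    case False
    from rhs obtain k where k: "\<And>i x. \<lbrakk>i \<ge> k; x \<in> adic i\<rbrakk> \<Longrightarrow> a \<odot>\<^bsub>M\<^esub> x \<in> adic (n + i)"
      by (auto simp: eventually_sequentially)
    have "k \<le> n * Suc k" using False by (cases n) auto
    with k aR have "a \<in> colon_ideal R M (adic (n + n * Suc k)) (adic (n * Suc k))"
      by (simp add: colon_ideal_def)
    then show ?thesis unfolding r_filtration_eq by (intro UN_I[of "Suc k"]) simp_all
  qed
qed

lemma mem_ratliff_rush_filtration_iff:
  "z \<in> ratliff_rush_filtration R M I n \<longleftrightarrow> z \<in> carrier M \<and>
    (\<forall>\<^sub>F k in sequentially. \<forall>b\<in>ideal_power R I k. b \<odot>\<^bsub>M\<^esub> z \<in> adic (n + k))"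
proof
  assume "z \<in> ratliff_rush_filtration R M I n"
  then obtain k where k: "z \<in> colon_submodule M (adic (n + n * k)) (ideal_power R I (n * k))"
    by (auto simp: ratliff_rush_filtration_eq)
  have "\<forall>b\<in>ideal_power R I i. b \<odot>\<^bsub>M\<^esub> z \<in> adic (n + i)" if "i \<ge> n * k" for i
    using colon_submodule_adic_mono[OF k, of "i - n * k"] that by (auto simp: colon_submodule_def)
  then have "\<forall>\<^sub>F i in sequentially. \<forall>b\<in>ideal_power R I i. b \<odot>\<^bsub>M\<^esub> z \<in> adic (n + i)"
    by (auto simp: eventually_sequentially)
  with k show "z \<in> carrier M \<and>
      (\<forall>\<^sub>F i in sequentially. \<forall>b\<in>ideal_power R I i. b \<odot>\<^bsub>M\<^esub> z \<in> adic (n + i))"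
    by (auto simp: colon_submodule_def)
next
  assume rhs: "z \<in> carrier M \<and>
    (\<forall>\<^sub>F k in sequentially. \<forall>b\<in>ideal_power R I k. b \<odot>\<^bsub>M\<^esub> z \<in> adic (n + k))"
  then have zM: "z \<in> carrier M" by simp
  show "z \<in> ratliff_rush_filtration R M I n"
  proof (cases "n = 0")
    case True
    have "z \<in> colon_submodule M (adic (n + n * 1)) (ideal_power R I (n * 1))"
      using True zM adic_0 ideal_power_subset[of _ 0] by (auto simp: colon_submodule_def)
    then show ?thesis unfolding ratliff_rush_filtration_eq by blast
  next
    case False
    from rhs obtain k
      where k: "\<And>i b. \<lbrakk>i \<ge> k; b \<in> ideal_power R I i\<rbrakk> \<Longrightarrow> b \<odot>\<^bsub>M\<^esub> z \<in> adic (n + i)"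
      by (auto simp: eventually_sequentially)
    have "k \<le> n * Suc k" using False by (cases n) auto
    with k zM have "z \<in> colon_submodule M (adic (n + n * Suc k)) (ideal_power R I (n * Suc k))"
      by (simp add: colon_submodule_def)
    then show ?thesis unfolding ratliff_rush_filtration_eq by (intro UN_I[of "Suc k"]) simp_all
  qed
qed

lemma additive_subgroup_r_filtration: "additive_subgroup (r_filtration R M I n) R"
proof (rule R.additive_subgroup_criterion)
  note adic = submoduleE[OF submodule_adic]
  show "r_filtration R M I n \<subseteq> carrier R"
    by (auto simp: mem_r_filtration_iff)
  show "\<zero> \<in> r_filtration R M I n"
    by (auto simp: mem_r_filtration_iff adic_subset adic_zero)
  show "a \<oplus> b \<in> r_filtration R M I n"
    if "a \<in> r_filtration R M I n" "b \<in> r_filtration R M I n" for a b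
  proof -
    have ab: "a \<in> carrier R" "b \<in> carrier R"
      using that by (auto simp: mem_r_filtration_iff)
    have "\<forall>\<^sub>F k in sequentially. \<forall>x\<in>adic k. a \<odot>\<^bsub>M\<^esub> x \<in> adic (n + k)"
      "\<forall>\<^sub>F k in sequentially. \<forall>x\<in>adic k. b \<odot>\<^bsub>M\<^esub> x \<in> adic (n + k)"
      using that by (auto simp: mem_r_filtration_iff)
    then have "\<forall>\<^sub>F k in sequentially. \<forall>x\<in>adic k. (a \<oplus> b) \<odot>\<^bsub>M\<^esub> x \<in> adic (n + k)"
      by eventually_elim (simp add: smult_l_distr ab adic_subset adic)
    with ab show ?thesis by (simp add: mem_r_filtration_iff)
  qed
  show "\<ominus> a \<in> r_filtration R M I n" if "a \<in> r_filtration R M I n" for a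
  proof -
    have a: "a \<in> carrier R" and
      "\<forall>\<^sub>F k in sequentially. \<forall>x\<in>adic k. a \<odot>\<^bsub>M\<^esub> x \<in> adic (n + k)"
      using that by (auto simp: mem_r_filtration_iff)
    from this(2) have "\<forall>\<^sub>F k in sequentially. \<forall>x\<in>adic k. \<ominus> a \<odot>\<^bsub>M\<^esub> x \<in> adic (n + k)"
      by eventually_elim (simp add: smult_l_minus a adic_subset adic)
    with a show ?thesis by (simp add: mem_r_filtration_iff)
  qed
qed

lemma additive_subgroup_ratliff_rush_filtration:
  "additive_subgroup (ratliff_rush_filtration R M I n) M"
proof (rule M.additive_subgroup_criterion)
  note adic = submoduleE[OF submodule_adic]
  show "ratliff_rush_filtration R M I n \<subseteq> carrier M"
    by (auto simp: mem_ratliff_rush_filtration_iff)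
  show "\<zero>\<^bsub>M\<^esub> \<in> ratliff_rush_filtration R M I n"
    by (auto simp: mem_ratliff_rush_filtration_iff ideal_power_subset adic_zero)
  show "y \<oplus>\<^bsub>M\<^esub> z \<in> ratliff_rush_filtration R M I n"
    if "y \<in> ratliff_rush_filtration R M I n" "z \<in> ratliff_rush_filtration R M I n" for y z
  proof -
    have yz: "y \<in> carrier M" "z \<in> carrier M"
      using that by (auto simp: mem_ratliff_rush_filtration_iff)
    have "\<forall>\<^sub>F k in sequentially. \<forall>b\<in>ideal_power R I k. b \<odot>\<^bsub>M\<^esub> y \<in> adic (n + k)"
      "\<forall>\<^sub>F k in sequentially. \<forall>b\<in>ideal_power R I k. b \<odot>\<^bsub>M\<^esub> z \<in> adic (n + k)"
      using that by (auto simp: mem_ratliff_rush_filtration_iff)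
    then have "\<forall>\<^sub>F k in sequentially. \<forall>b\<in>ideal_power R I k. b \<odot>\<^bsub>M\<^esub> (y \<oplus>\<^bsub>M\<^esub> z) \<in> adic (n + k)"
      by eventually_elim (simp add: smult_r_distr yz ideal_power_subset adic)
    with yz show ?thesis by (simp add: mem_ratliff_rush_filtration_iff)
  qed
  show "\<ominus>\<^bsub>M\<^esub> z \<in> ratliff_rush_filtration R M I n" if "z \<in> ratliff_rush_filtration R M I n" for z
  proof -
    have z: "z \<in> carrier M" and
      "\<forall>\<^sub>F k in sequentially. \<forall>b\<in>ideal_power R I k. b \<odot>\<^bsub>M\<^esub> z \<in> adic (n + k)"
      using that by (auto simp: mem_ratliff_rush_filtration_iff)
    from this(2) have "\<forall>\<^sub>F k in sequentially. \<forall>b\<in>ideal_power R I k. b \<odot>\<^bsub>M\<^esub> (\<ominus>\<^bsub>M\<^esub> z) \<in> adic (n + k)"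
      by eventually_elim (simp add: smult_r_minus z ideal_power_subset adic)
    with z show ?thesis by (simp add: mem_ratliff_rush_filtration_iff)
  qed
qed

lemma one_mem_r_filtration: "\<one> \<in> r_filtration R M I 0"
  unfolding mem_r_filtration_iff by (simp add: adic_subset)

text \<open>
  For large \<open>k\<close> one has \<open>a b I\<^sup>k M \<subseteq> a I\<^sup>n\<^sup>+\<^sup>k M \<subseteq> I\<^sup>m\<^sup>+\<^sup>n\<^sup>+\<^sup>k M\<close>. The condition on \<open>a\<close> is used at
  index \<open>k + n\<close>, hence the shift along \<open>sequentially\<close>.
\<close>

lemma r_filtration_mult:
  assumes "a \<in> r_filtration R M I m" "b \<in> r_filtration R M I n"
  shows "a \<otimes> b \<in> r_filtration R M I (m + n)"
proof -
  have ab: "a \<in> carrier R" "b \<in> carrier R"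
    using assms by (auto simp: mem_r_filtration_iff)
  have "\<forall>\<^sub>F k in sequentially. \<forall>x\<in>adic k. a \<odot>\<^bsub>M\<^esub> x \<in> adic (m + k)"
    using assms by (auto simp: mem_r_filtration_iff)
  then have "\<forall>\<^sub>F k in sequentially. \<forall>x\<in>adic (k + n). a \<odot>\<^bsub>M\<^esub> x \<in> adic (m + (k + n))"
    by (rule sequentially_offset)
  moreover have "\<forall>\<^sub>F k in sequentially. \<forall>x\<in>adic k. b \<odot>\<^bsub>M\<^esub> x \<in> adic (n + k)"
    using assms by (auto simp: mem_r_filtration_iff)
  ultimately have "\<forall>\<^sub>F k in sequentially. \<forall>x\<in>adic k. (a \<otimes> b) \<odot>\<^bsub>M\<^esub> x \<in> adic (m + n + k)"
    by eventually_elim (simp add: smult_assoc1 ab adic_subset ac_simps)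
  with ab show ?thesis by (simp add: mem_r_filtration_iff)
qed

text \<open>
  The same computation with \<open>z\<close> in place of \<open>b\<close>; commutativity moves \<open>a\<close> in front of the elements
  of \<open>I\<^sup>k\<close>.
\<close>

lemma r_filtration_smult:
  assumes "a \<in> r_filtration R M I m" "z \<in> ratliff_rush_filtration R M I n"
  shows "a \<odot>\<^bsub>M\<^esub> z \<in> ratliff_rush_filtration R M I (m + n)"
proof -
  have az: "a \<in> carrier R" "z \<in> carrier M"
    using assms by (auto simp: mem_r_filtration_iff mem_ratliff_rush_filtration_iff)
  have comm: "b \<odot>\<^bsub>M\<^esub> (a \<odot>\<^bsub>M\<^esub> z) = a \<odot>\<^bsub>M\<^esub> (b \<odot>\<^bsub>M\<^esub> z)" if "b \<in> carrier R" for b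
    using az that by (simp flip: smult_assoc1 add: R.m_comm)
  have "\<forall>\<^sub>F k in sequentially. \<forall>x\<in>adic k. a \<odot>\<^bsub>M\<^esub> x \<in> adic (m + k)"
    using assms by (auto simp: mem_r_filtration_iff)
  then have "\<forall>\<^sub>F k in sequentially. \<forall>x\<in>adic (k + n). a \<odot>\<^bsub>M\<^esub> x \<in> adic (m + (k + n))"
    by (rule sequentially_offset)
  moreover have "\<forall>\<^sub>F k in sequentially. \<forall>b\<in>ideal_power R I k. b \<odot>\<^bsub>M\<^esub> z \<in> adic (n + k)"
    using assms by (auto simp: mem_ratliff_rush_filtration_iff)
  ultimately have "\<forall>\<^sub>F k in sequentially. \<forall>b\<in>ideal_power R I k.
      b \<odot>\<^bsub>M\<^esub> (a \<odot>\<^bsub>M\<^esub> z) \<in> adic (m + n + k)"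
    by eventually_elim (simp add: comm ideal_power_subset ac_simps)
  with az show ?thesis by (simp add: mem_ratliff_rush_filtration_iff)
qed

lemma filtered_module_ratliff_rush:
  "filtered_module R M (r_filtration R M I) (ratliff_rush_filtration R M I)"
  by (intro filtered_module.intro filtered_module_axioms.intro)
     (rule module_axioms additive_subgroup_r_filtration one_mem_r_filtration r_filtration_mult
       additive_subgroup_ratliff_rush_filtration r_filtration_smult | assumption)+

end

theorem proposition2p4:
  fixes R :: "('a, 'r) ring_scheme"
    and M :: "('a, 'b, 'm) module_scheme"
    and I :: "'a set"
  assumes "cring R"
    and "noetherian_ring R"
    and "ideal I R"
    and "module R M"
    and "finitely_generated_module R M"
  shows "graded_module
    (rees_ring R (r_filtration R M I))
    (homogeneous_part R (r_filtration R M I))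
    (rees_module M (ratliff_rush_filtration R M I))
    (homogeneous_part M (ratliff_rush_filtration R M I))"
proof -
  have "module_with_ideal R M I"
    using assms(3,4) by (intro module_with_ideal.intro module_with_ideal_axioms.intro)
  then show ?thesis
    by (intro filtered_module.graded_module_rees_module
        module_with_ideal.filtered_module_ratliff_rush)
qed

end
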